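(* Let $L(\lambda)=\lambda M+K\in\mathbb{C}^{n\times n}[\lambda]$ be a regular matrix pencil with complementary deflating pairs $(X_c,\Lambda_c)\in\mathbb{C}^{n\times p}\times\mathbb{C}^{p\times p}$ and $(X_f,\Lambda_f)\in\mathbb{C}^{n\times(n-p)}\times\mathbb{C}^{(n-p)\times(n-p)}$. Let $(X_a,\Lambda_a)\in\mathbb{C}^{n\times p}\times\mathbb{C}^{p\times p}$ be such that $[X_a\ X_f]$ is nonsingular. Set $$R_a:=-(MX_a\Lambda_a+KX_a)\in\mathbb{C}^{n\times p},\qquad A:=\begin{bmatrix}X_f\Lambda_f & X_a\Lambda_a\\ X_f & X_a\end{bmatrix}\in\mathbb{C}^{2n\times n},\qquad B:=\begin{bmatrix}0 & R_a\end{bmatrix}\in\mathbb{C}^{n\times n}.$$ Then $A^*A$ is nonsingular, and for matrices $\Delta M,\Delta K\in\mathbb{C}^{n\times n}$ the pairs $(X_a,\Lambda_a)$ and $(X_f,\Lambda_f)$ are complementary deflating pairs of the perturbed pencil $L_\Delta(\lambda)=\lambda(M+\Delta M)+(K+\Delta K)$ if and only if $$\begin{bmatrix}\Delta M & \Delta K\end{bmatrix}=BA^\dagger+Z(I_{2n}-AA^\dagger)\quad\text{for some } Z\in\mathbb{C}^{n\times 2n},$$ where $A^\dagger=(A^*A)^{-1}A^*$ is the Moore–Penrose generalized inverse of $A$.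
   Context: A pencil $\lambda M+K\in\mathbb{C}^{n\times n}[\lambda]$ is regular if $\det(\lambda M+K)$ is not the zero polynomial. A deflating pair of a pencil $\lambda M+K\in\mathbb{C}^{n\times n}[\lambda]$ is a matrix pair $(X,\Lambda)\in\mathbb{C}^{n\times p}\times\mathbb{C}^{p\times p}$ with $\operatorname{rank}X=p\le n$ and $MX\Lambda+KX=0$ ($\Lambda$ need not be diagonal). Two deflating pairs $(X_1,\Lambda_1)$, $(X_2,\Lambda_2)$ are complementary if $[X_1\ X_2]$ is a nonsingular square matrix. $A^*$ denotes the conjugate transpose. *)

theory Defs
  imports
    "Jordan_Normal_Form.DL_Rank"
    "Jordan_Normal_Form.Gauss_Jordan_Elimination"
    "Jordan_Normal_Form.Schur_Decomposition"
    "HOL-Computational_Algebra.Polynomial"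
begin

definition append_cols :: "'a::zero mat \<Rightarrow> 'a mat \<Rightarrow> 'a mat" (infixr \<open>@\<^sub>c\<close> 65) where
  "A @\<^sub>c B = four_block_mat A B (0\<^sub>m 0 (dim_col A)) (0\<^sub>m 0 (dim_col B))"

text \<open>The pencil \<open>\<lambda> M + K\<close> as a matrix over \<open>\<complex>[\<lambda>]\<close>; the indeterminate is \<^term>\<open>[:0, 1:]\<close>.\<close>

definition pencil :: "complex mat \<Rightarrow> complex mat \<Rightarrow> complex poly mat" where
  "pencil M K = [:0, 1:] \<cdot>\<^sub>m map_mat (\<lambda>a. [:a:]) M + map_mat (\<lambda>a. [:a:]) K"

definition regular_pencil :: "complex mat \<Rightarrow> complex mat \<Rightarrow> bool" where
  "regular_pencil M K \<longleftrightarrow> det (pencil M K) \<noteq> 0"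

definition deflating_pair ::
  "nat \<Rightarrow> complex mat \<Rightarrow> complex mat \<Rightarrow> nat \<Rightarrow> complex mat \<Rightarrow> complex mat \<Rightarrow> bool" where
  "deflating_pair n M K p X \<Lambda> \<longleftrightarrow>
     M \<in> carrier_mat n n \<and> K \<in> carrier_mat n n \<and>
     X \<in> carrier_mat n p \<and> \<Lambda> \<in> carrier_mat p p \<and>
     p \<le> n \<and> vec_space.rank n X = p \<and>
     M * X * \<Lambda> + K * X = 0\<^sub>m n p"

definition complementary_deflating_pairs ::
  "nat \<Rightarrow> complex mat \<Rightarrow> complex mat \<Rightarrow>
   nat \<Rightarrow> complex mat \<Rightarrow> complex mat \<Rightarrow> nat \<Rightarrow> complex mat \<Rightarrow> complex mat \<Rightarrow> bool" where
  "complementary_deflating_pairs n M K p X\<^sub>1 \<Lambda>\<^sub>1 q X\<^sub>2 \<Lambda>\<^sub>2 \<longleftrightarrow>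
     deflating_pair n M K p X\<^sub>1 \<Lambda>\<^sub>1 \<and> deflating_pair n M K q X\<^sub>2 \<Lambda>\<^sub>2 \<and>
     invertible_mat (X\<^sub>1 @\<^sub>c X\<^sub>2)"

text \<open>Meaningful only if \<open>A\<^sup>* A\<close> is nonsingular, since otherwise \<^const>\<open>mat_inverse\<close>
  returns \<^const>\<open>None\<close>.\<close>

definition pinv :: "complex mat \<Rightarrow> complex mat" where
  "pinv A = the (mat_inverse (mat_adjoint A * A)) * mat_adjoint A"

text \<open>The four Penrose conditions.\<close>

definition is_moore_penrose_inverse :: "complex mat \<Rightarrow> complex mat \<Rightarrow> bool" where
  "is_moore_penrose_inverse A G \<longleftrightarrow>
     G \<in> carrier_mat (dim_col A) (dim_row A) \<and>
     A * G * A = A \<and> G * A * G = G \<and>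
     mat_adjoint (A * G) = A * G \<and> mat_adjoint (G * A) = G * A"

end

theory Submission
  imports Defs
begin

text \<open>
  Both residual equations of the perturbed pencil are one linear system: reading
  \<open>(M + \<Delta>M) X \<Lambda> + (K + \<Delta>K) X = 0\<close> for \<open>X = X\<^sub>f\<close> and \<open>X = X\<^sub>a\<close> side by side, and using that
  the unperturbed residual vanishes at \<open>X\<^sub>f\<close> and equals \<open>- R\<^sub>a\<close> at \<open>X\<^sub>a\<close>, they say exactly
  \<open>[\<Delta>M \<Delta>K] A = B\<close>. Everything else in the notion of complementary deflating pairs is
  independent of the perturbation: the ranks are full because \<open>[X\<^sub>a X\<^sub>f]\<close> is nonsingular.

  The lower half \<open>[X\<^sub>f X\<^sub>a]\<close> of \<open>A\<close> is a nonsingular matrix, so \<open>A\<close> has a left inverse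
  (\<open>complementary_left_inverses\<close> supplies its blocks). Hence \<open>A x = 0\<close> only for \<open>x = 0\<close>, and
  since \<open>x\<^sup>* A\<^sup>* A x = \<parallel>A x\<parallel>\<^sup>2\<close>, the Gram matrix \<open>A\<^sup>* A\<close> is nonsingular
  (\<open>gram_matrix_nonsingular\<close>). So the pseudoinverse is itself a left inverse of \<open>A\<close>, and
  for any left inverse \<open>G\<close> the solutions of \<open>D A = B\<close> are the particular solution \<open>B G\<close> plus
  the row-annihilator of \<open>A\<close>, which is the range of \<open>Z \<mapsto> Z (I - A G)\<close>
  (\<open>left_inverse_solutions\<close>).
\<close>

section \<open>Adjoints\<close>

lemma mat_adjoint_carrier [simp]:
  "A \<in> carrier_mat m n \<Longrightarrow> mat_adjoint A \<in> carrier_mat n m"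
  unfolding mat_adjoint_def by auto

lemma mat_adjoint_index:
  "i < dim_col A \<Longrightarrow> j < dim_row A \<Longrightarrow> mat_adjoint A $$ (i, j) = conjugate (A $$ (j, i))"
  unfolding mat_adjoint_def by (simp add: mat_of_rows_index)

lemma mat_adjoint_adjoint: "mat_adjoint (mat_adjoint A) = A"
proof (rule eq_matI)
  have c: "mat_adjoint A \<in> carrier_mat (dim_col A) (dim_row A)"
    by simp
  have cc: "mat_adjoint (mat_adjoint A) \<in> carrier_mat (dim_row A) (dim_col A)"
    using c by simp
  show "dim_row (mat_adjoint (mat_adjoint A)) = dim_row A"
    "dim_col (mat_adjoint (mat_adjoint A)) = dim_col A"
    using carrier_matD[OF cc] by auto
  show "mat_adjoint (mat_adjoint A) $$ (i, j) = A $$ (i, j)"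
    if "i < dim_row A" "j < dim_col A" for i j
    using that c by (simp add: mat_adjoint_index carrier_matD[OF c])
qed

lemma mat_adjoint_one: "mat_adjoint (1\<^sub>m n :: complex mat) = 1\<^sub>m n"
proof (rule eq_matI)
  have c: "mat_adjoint (1\<^sub>m n :: complex mat) \<in> carrier_mat n n" by simp
  show "dim_row (mat_adjoint (1\<^sub>m n :: complex mat)) = dim_row (1\<^sub>m n :: complex mat)"
    "dim_col (mat_adjoint (1\<^sub>m n :: complex mat)) = dim_col (1\<^sub>m n :: complex mat)"
    using carrier_matD[OF c] by auto
qed (auto simp: mat_adjoint_index)

lemma mat_adjoint_mult:
  assumes A: "A \<in> carrier_mat m n" and B: "B \<in> carrier_mat n k"
  shows "mat_adjoint (A * B) = mat_adjoint B * mat_adjoint (A :: complex mat)"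
proof (rule eq_matI)
  note cA = carrier_matD[OF mat_adjoint_carrier[OF A]]
  note cB = carrier_matD[OF mat_adjoint_carrier[OF B]]
  note cAB = carrier_matD[OF mat_adjoint_carrier[OF mult_carrier_mat[OF A B]]]
  show "dim_row (mat_adjoint (A * B)) = dim_row (mat_adjoint B * mat_adjoint A)"
    "dim_col (mat_adjoint (A * B)) = dim_col (mat_adjoint B * mat_adjoint A)"
    using cA cB cAB by auto
  show "mat_adjoint (A * B) $$ (i, j) = (mat_adjoint B * mat_adjoint A) $$ (i, j)"
    if ij: "i < dim_row (mat_adjoint B * mat_adjoint A)"
      "j < dim_col (mat_adjoint B * mat_adjoint A)" for i j
    using ij A B cA cB
    by (simp add: mat_adjoint_index scalar_prod_def sum_conjugate mult.commute)
qed

section \<open>The pseudoinverse of a matrix with a left inverse\<close>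

text \<open>A kernel vector \<open>x\<close> of \<open>A\<^sup>* A\<close> satisfies \<open>\<parallel>A x\<parallel>\<^sup>2 = x\<^sup>* A\<^sup>* A x = 0\<close>, and the left inverse
  then recovers \<open>x = G A x = 0\<close>.\<close>

lemma gram_matrix_nonsingular:
  fixes A :: "complex mat"
  assumes A: "A \<in> carrier_mat m n" and G: "G \<in> carrier_mat n m" and GA: "G * A = 1\<^sub>m n"
  shows "det (mat_adjoint A * A) \<noteq> 0"
proof
  note H = mat_adjoint_carrier[OF A]
  assume "det (mat_adjoint A * A) = 0"
  then obtain x where x: "x \<in> carrier_vec n" "x \<noteq> 0\<^sub>v n"
    and Nx: "(mat_adjoint A * A) *\<^sub>v x = 0\<^sub>v n"
    using det_0_iff_vec_prod_zero[OF mult_carrier_mat[OF H A]] by auto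
  have Ax: "A *\<^sub>v x \<in> carrier_vec m" using A x by simp
  have HAx: "mat_adjoint A *\<^sub>v (A *\<^sub>v x) = 0\<^sub>v n"
    using assoc_mult_mat_vec[OF H A x(1)] Nx by simp
  have "(A *\<^sub>v x) \<bullet>c (A *\<^sub>v x)
      = (\<Sum>j<m. \<Sum>i<n. A $$ (j, i) * x $ i * cnj ((A *\<^sub>v x) $ j))"
    using A x Ax by (simp add: scalar_prod_def sum_distrib_right lessThan_atLeast0)
  also have "\<dots> = (\<Sum>i<n. x $ i * cnj (\<Sum>j<m. cnj (A $$ (j, i)) * (A *\<^sub>v x) $ j))"
    by (subst sum.swap) (simp add: sum_distrib_left mult_ac)
  also have "\<dots> = (\<Sum>i<n. x $ i * cnj ((mat_adjoint A *\<^sub>v (A *\<^sub>v x)) $ i))"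
    using carrier_matD[OF A] carrier_matD[OF H] carrier_vecD[OF Ax]
    by (simp add: scalar_prod_def mat_adjoint_index lessThan_atLeast0)
  also have "\<dots> = 0" unfolding HAx by simp
  finally have "A *\<^sub>v x = 0\<^sub>v m" using Ax by simp
  then have "(G * A) *\<^sub>v x = 0\<^sub>v n"
    using assoc_mult_mat_vec[OF G A x(1)] G by (auto intro!: eq_vecI)
  with GA x show False by simp
qed

lemma invertible_matI:
  assumes "A \<in> carrier_mat n n" "C \<in> carrier_mat n n" "A * C = 1\<^sub>m n" "C * A = 1\<^sub>m n"
  shows "invertible_mat A"
  using assms unfolding invertible_mat_def inverts_mat_def by auto

text \<open>The Penrose conditions come down to \<open>A\<^sup>\<dagger> A = I\<close> and to \<open>A (A\<^sup>* A)\<inverse> A\<^sup>*\<close> being Hermitian,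
  for which the inverse of the Hermitian matrix \<open>A\<^sup>* A\<close> has to be Hermitian.\<close>

lemma pinv_of_left_invertible:
  fixes A :: "complex mat"
  assumes A: "A \<in> carrier_mat m n" and G: "G \<in> carrier_mat n m" and GA: "G * A = 1\<^sub>m n"
  shows "invertible_mat (mat_adjoint A * A)"
    and "pinv A \<in> carrier_mat n m"
    and "pinv A * A = 1\<^sub>m n"
    and "is_moore_penrose_inverse A (pinv A)"
proof -
  define H where "H = mat_adjoint A"
  have H: "H \<in> carrier_mat n m" unfolding H_def using A by simp
  have HA: "H * A \<in> carrier_mat n n" using H A by simp
  have "H * A \<in> Units (ring_mat TYPE(complex) n ())"
    by (rule det_non_zero_imp_unit[OF HA], unfold H_def, rule gram_matrix_nonsingular[OF A G GA])
  then obtain C where inv: "mat_inverse (H * A) = Some C"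
    using mat_inverse(1)[OF HA, where b = "()"] by (cases "mat_inverse (H * A)") auto
  from mat_inverse(2)[OF HA inv]
  have NC: "H * A * C = 1\<^sub>m n" and CN: "C * (H * A) = 1\<^sub>m n" and C: "C \<in> carrier_mat n n"
    by auto
  have pinv: "pinv A = C * H"
    using inv unfolding pinv_def H_def by simp
  show "invertible_mat (mat_adjoint A * A)"
    using invertible_matI[OF HA C NC CN] unfolding H_def .
  show P: "pinv A \<in> carrier_mat n m" unfolding pinv using C H by simp
  show PA: "pinv A * A = 1\<^sub>m n"
    unfolding pinv using CN assoc_mult_mat[OF C H A] by simp
  have adjH: "mat_adjoint H = A" unfolding H_def by (rule mat_adjoint_adjoint)
  have adjN: "mat_adjoint (H * A) = H * A"
    using mat_adjoint_mult[OF H A] adjH unfolding H_def by simp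
  have C': "mat_adjoint C \<in> carrier_mat n n" using C by simp
  have NC': "H * A * mat_adjoint C = 1\<^sub>m n"
    using mat_adjoint_mult[OF C HA] CN adjN by (simp add: mat_adjoint_one)
  have adjC: "mat_adjoint C = C"
    using assoc_mult_mat[OF C HA C'] CN NC' C C' by simp
  have "mat_adjoint (A * pinv A) = mat_adjoint (C * H) * H"
    using mat_adjoint_mult[OF A P] unfolding pinv H_def by simp
  also have "\<dots> = A * C * H" using mat_adjoint_mult[OF C H] adjC adjH by simp
  also have "\<dots> = A * pinv A" unfolding pinv using assoc_mult_mat[OF A C H] .
  finally have "mat_adjoint (A * pinv A) = A * pinv A" .
  moreover have "A * pinv A * A = A" using assoc_mult_mat[OF A P A] PA A by simp
  moreover have "pinv A * A * pinv A = pinv A" using PA P by simp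
  moreover have "mat_adjoint (pinv A * A) = pinv A * A" using PA by (simp add: mat_adjoint_one)
  ultimately show "is_moore_penrose_inverse A (pinv A)"
    unfolding is_moore_penrose_inverse_def using P A by auto
qed

text \<open>Every solution \<open>D\<close> is its own parameter \<open>Z\<close>, since \<open>D = D A G + D (I - A G)\<close>; conversely
  \<open>I - A G\<close> is annihilated by \<open>A\<close> from the right.\<close>

lemma left_inverse_solutions:
  fixes A :: "'a::comm_ring_1 mat"
  assumes A: "A \<in> carrier_mat m n" and G: "G \<in> carrier_mat n m" and GA: "G * A = 1\<^sub>m n"
    and B: "B \<in> carrier_mat k n" and D: "D \<in> carrier_mat k m"
  shows "D * A = B \<longleftrightarrow> (\<exists>Z \<in> carrier_mat k m. D = B * G + Z * (1\<^sub>m m - A * G))"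
proof
  have AG: "A * G \<in> carrier_mat m m" using A G by simp
  show "\<exists>Z \<in> carrier_mat k m. D = B * G + Z * (1\<^sub>m m - A * G)" if "D * A = B"
  proof
    have "B * G = D * (A * G)" using that assoc_mult_mat[OF D A G] by simp
    moreover have "D * (1\<^sub>m m - A * G) = D - D * (A * G)"
      using mult_minus_distrib_mat[OF D one_carrier_mat AG] D by simp
    ultimately show "D = B * G + D * (1\<^sub>m m - A * G)"
      using D mult_carrier_mat[OF D AG] by (intro eq_matI) auto
  qed (rule D)
  show "D * A = B" if "\<exists>Z \<in> carrier_mat k m. D = B * G + Z * (1\<^sub>m m - A * G)"
  proof -
    from that obtain Z where Z: "Z \<in> carrier_mat k m"
      and DZ: "D = B * G + Z * (1\<^sub>m m - A * G)" by blast
    have E: "1\<^sub>m m - A * G \<in> carrier_mat m m" using minus_carrier_mat[OF AG] .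
    have "(1\<^sub>m m - A * G) * A = A - A * (G * A)"
      using minus_mult_distrib_mat[OF one_carrier_mat AG A] assoc_mult_mat[OF A G A] A by simp
    also have "\<dots> = 0\<^sub>m m n" using GA A by simp
    finally have EA: "(1\<^sub>m m - A * G) * A = 0\<^sub>m m n" .
    have "D * A = B * (G * A) + Z * ((1\<^sub>m m - A * G) * A)"
      unfolding DZ
      using add_mult_distrib_mat[OF mult_carrier_mat[OF B G] mult_carrier_mat[OF Z E] A]
        assoc_mult_mat[OF B G A] assoc_mult_mat[OF Z E A] by simp
    also have "\<dots> = B" unfolding GA EA using B Z by simp
    finally show ?thesis .
  qed
qed

section \<open>Columns side by side\<close>

lemma append_cols_carrier [simp]:
  "X \<in> carrier_mat n p \<Longrightarrow> Y \<in> carrier_mat n q \<Longrightarrow> X @\<^sub>c Y \<in> carrier_mat n (p + q)"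
  unfolding append_cols_def by auto

lemma append_cols_eq_iff:
  assumes "X \<in> carrier_mat n p" "Y \<in> carrier_mat n q" "X' \<in> carrier_mat n p" "Y' \<in> carrier_mat n q"
  shows "X @\<^sub>c Y = X' @\<^sub>c Y' \<longleftrightarrow> X = X' \<and> Y = Y'"
proof
  assume eq: "X @\<^sub>c Y = X' @\<^sub>c Y'"
  have idx: "(X @\<^sub>c Y) $$ (i, j) = (X' @\<^sub>c Y') $$ (i, j)" for i j using eq by simp
  have "X $$ (i, j) = X' $$ (i, j)" if "i < n" "j < p" for i j
    using idx[of i j] that assms unfolding append_cols_def by simp
  moreover have "Y $$ (i, j) = Y' $$ (i, j)" if "i < n" "j < q" for i j
    using idx[of i "p + j"] that assms unfolding append_cols_def by simp
  ultimately show "X = X' \<and> Y = Y'" using assms by (auto intro!: eq_matI)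
qed simp

lemma append_cols_mult_four_block:
  fixes D E :: "'a::semiring_0 mat"
  assumes D: "D \<in> carrier_mat k m" and E: "E \<in> carrier_mat k l"
    and blocks: "A1 \<in> carrier_mat m p" "A2 \<in> carrier_mat m q"
      "A3 \<in> carrier_mat l p" "A4 \<in> carrier_mat l q"
  shows "(D @\<^sub>c E) * four_block_mat A1 A2 A3 A4 = (D * A1 + E * A3) @\<^sub>c (D * A2 + E * A4)"
proof -
  have "(D @\<^sub>c E) * four_block_mat A1 A2 A3 A4
      = four_block_mat (D * A1 + E * A3) (D * A2 + E * A4)
          (0\<^sub>m 0 m * A1 + 0\<^sub>m 0 l * A3) (0\<^sub>m 0 m * A2 + 0\<^sub>m 0 l * A4)"
    unfolding append_cols_def carrier_matD[OF D] carrier_matD[OF E]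
    by (rule mult_four_block_mat[OF D E zero_carrier_mat zero_carrier_mat blocks])
  also have "\<dots> = (D * A1 + E * A3) @\<^sub>c (D * A2 + E * A4)"
    unfolding append_cols_def using blocks D E by (intro cong_four_block_mat) auto
  finally show ?thesis .
qed

text \<open>The two factors are the upper and the lower rows of \<open>[X Y]\<inverse>\<close>.\<close>

lemma complementary_left_inverses:
  fixes X Y :: "'a::comm_ring_1 mat"
  assumes X: "X \<in> carrier_mat n p" and Y: "Y \<in> carrier_mat n q" and n: "n = p + q"
    and inv: "invertible_mat (X @\<^sub>c Y)"
  obtains P Q where "P \<in> carrier_mat p n" "Q \<in> carrier_mat q n"
    "P * X = 1\<^sub>m p" "P * Y = 0\<^sub>m p q" "Q * X = 0\<^sub>m q p" "Q * Y = 1\<^sub>m q"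
proof -
  have XY: "X @\<^sub>c Y \<in> carrier_mat n n" using X Y n by auto
  obtain W where W1: "(X @\<^sub>c Y) * W = 1\<^sub>m n" and W2: "W * (X @\<^sub>c Y) = 1\<^sub>m (dim_row W)"
    using inv XY unfolding invertible_mat_def inverts_mat_def by auto
  have "dim_col W = n" using arg_cong[OF W1, of dim_col] by simp
  moreover have "dim_row W = n" using arg_cong[OF W2, of dim_col] XY by simp
  ultimately have W: "W \<in> carrier_mat n n" by auto
  have WXY: "W * (X @\<^sub>c Y) = 1\<^sub>m n" using W2 W by simp
  have colX: "col (X @\<^sub>c Y) j = col X j" if "j < p" for j
    using that X Y unfolding append_cols_def by (intro eq_vecI) auto
  have colY: "col (X @\<^sub>c Y) (p + j) = col Y j" if "j < q" for j
    using that X Y unfolding append_cols_def by (intro eq_vecI) auto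
  have WX: "row W i \<bullet> col X j = (if i = j then 1 else 0)" if "i < n" "j < p" for i j
    using arg_cong[OF WXY, of "\<lambda>T. T $$ (i, j)"] that n W XY colX by simp
  have WY: "row W i \<bullet> col Y j = (if i = p + j then 1 else 0)" if "i < n" "j < q" for i j
    using arg_cong[OF WXY, of "\<lambda>T. T $$ (i, p + j)"] that n W XY colY by simp
  define P where "P = mat p n (\<lambda>(i, j). W $$ (i, j))"
  define Q where "Q = mat q n (\<lambda>(i, j). W $$ (p + i, j))"
  have P: "P \<in> carrier_mat p n" and Q: "Q \<in> carrier_mat q n" unfolding P_def Q_def by auto
  have rowP: "row P i = row W i" if "i < p" for i
    using that W n unfolding P_def by (intro eq_vecI) auto
  have rowQ: "row Q i = row W (p + i)" if "i < q" for i
    using that W n unfolding Q_def by (intro eq_vecI) auto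
  show ?thesis
  proof (rule that[OF P Q])
    show "P * X = 1\<^sub>m p" "P * Y = 0\<^sub>m p q" "Q * X = 0\<^sub>m q p" "Q * Y = 1\<^sub>m q"
      using P Q X Y n WX WY rowP rowQ by (auto intro!: eq_matI)
  qed
qed

text \<open>The left inverse maps the columns of \<open>X\<close> to the unit vectors. Their distinctness is a
  separate step because \<^const>\<open>vec_space.rank\<close> is governed by the set of columns.\<close>

lemma rank_of_left_invertible:
  fixes X :: "'a::field mat"
  assumes X: "X \<in> carrier_mat n p" and P: "P \<in> carrier_mat p n" and PX: "P * X = 1\<^sub>m p"
  shows "vec_space.rank n X = p"
proof -
  interpret vec_space "TYPE('a)" n .
  have unit: "P *\<^sub>v col X j = unit_vec p j" if "j < p" for j
    using col_mult2[OF P X that] PX that by simp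
  have dist: "distinct (cols X)"
  proof (unfold distinct_conv_nth, intro allI impI notI)
    fix i j assume "i < length (cols X)" "j < length (cols X)" and ne: "i \<noteq> j"
      and eq: "cols X ! i = cols X ! j"
    then have ij: "i < p" "j < p" using X by auto
    have "col X i = col X j" using eq ij carrier_matD(2)[OF X] by simp
    then have "(unit_vec p i :: 'a vec) = unit_vec p j" using unit ij by metis
    then have "unit_vec p i $ i = (unit_vec p j $ i :: 'a)" by (rule arg_cong)
    then show False using ij ne by (simp only: index_unit_vec if_False) simp
  qed
  have "lin_indpt (set (cols X))"
  proof
    assume dep: "lin_dep (set (cols X))"
    obtain v where v: "v \<in> carrier_vec p" "v \<noteq> 0\<^sub>v p" "X *\<^sub>v v = 0\<^sub>v n"
      using lin_depE[OF X dep dist] .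
    have "v = (P * X) *\<^sub>v v" unfolding PX using one_mult_mat_vec[OF v(1)] by (rule sym)
    also have "\<dots> = P *\<^sub>v 0\<^sub>v n" unfolding assoc_mult_mat_vec[OF P X v(1)] v(3) ..
    also have "\<dots> = 0\<^sub>v p" using P by (intro eq_vecI) auto
    finally show False using v(2) by blast
  qed
  then show ?thesis by (rule lin_indpt_full_rank[OF X dist])
qed

section \<open>Perturbed pencils\<close>

text \<open>A pair with residual \<open>- R\<close> deflates the perturbed pencil iff the perturbation
  contributes exactly \<open>R\<close>; the products are bracketed as they appear in the block matrix \<open>A\<close>.\<close>

lemma perturbed_residual_zero_iff:
  fixes M K :: "'a::comm_ring_1 mat"
  assumes M: "M \<in> carrier_mat n n" "\<Delta>M \<in> carrier_mat n n"
    and K: "K \<in> carrier_mat n n" "\<Delta>K \<in> carrier_mat n n"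
    and X: "X \<in> carrier_mat n p" and L: "\<Lambda> \<in> carrier_mat p p"
  shows "(M + \<Delta>M) * X * \<Lambda> + (K + \<Delta>K) * X = 0\<^sub>m n p \<longleftrightarrow>
    \<Delta>M * (X * \<Lambda>) + \<Delta>K * X = - (M * X * \<Lambda> + K * X)"
proof -
  define S where "S = M * X * \<Lambda> + K * X"
  define T where "T = \<Delta>M * (X * \<Lambda>) + \<Delta>K * X"
  have XL: "X * \<Lambda> \<in> carrier_mat n p" using X L by simp
  have S: "S \<in> carrier_mat n p" and T: "T \<in> carrier_mat n p"
    unfolding S_def T_def using M K X L XL by auto
  have "(M + \<Delta>M) * X * \<Lambda> = M * X * \<Lambda> + \<Delta>M * (X * \<Lambda>)"
    using add_mult_distrib_mat[OF M XL] assoc_mult_mat[OF add_carrier_mat[OF M(2), of M] X L]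
      assoc_mult_mat[OF M(1) X L] by simp
  moreover have "(K + \<Delta>K) * X = K * X + \<Delta>K * X" using add_mult_distrib_mat[OF K X] .
  moreover have "M * X * \<Lambda> \<in> carrier_mat n p" "\<Delta>M * (X * \<Lambda>) \<in> carrier_mat n p"
    "K * X \<in> carrier_mat n p" "\<Delta>K * X \<in> carrier_mat n p"
    using M K X L XL by auto
  ultimately have "(M + \<Delta>M) * X * \<Lambda> + (K + \<Delta>K) * X = S + T"
    unfolding S_def T_def by (intro eq_matI) auto
  moreover have "S + T = 0\<^sub>m n p \<longleftrightarrow> T = - S"
  proof
    assume eq: "S + T = 0\<^sub>m n p"
    have "S $$ (i, j) + T $$ (i, j) = 0" if "i < n" "j < p" for i j
      using arg_cong[OF eq, of "\<lambda>U. U $$ (i, j)"] that S T by simp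
    then show "T = - S" using S T
      by (intro eq_matI) (auto simp: eq_neg_iff_add_eq_0 add.commute)
  next
    assume "T = - S"
    then show "S + T = 0\<^sub>m n p" using S by (intro eq_matI) auto
  qed
  ultimately show ?thesis unfolding S_def T_def by simp
qed

theorem mainTheorem1:
  fixes n p :: nat
    and M K X\<^sub>c \<Lambda>\<^sub>c X\<^sub>f \<Lambda>\<^sub>f X\<^sub>a \<Lambda>\<^sub>a R\<^sub>a A B :: "complex mat"
  assumes M: "M \<in> carrier_mat n n"
    and K: "K \<in> carrier_mat n n"
    and regular: "regular_pencil M K"
    and p_le_n: "p \<le> n"
    and compl: "complementary_deflating_pairs n M K p X\<^sub>c \<Lambda>\<^sub>c (n - p) X\<^sub>f \<Lambda>\<^sub>f"
    and Xa: "X\<^sub>a \<in> carrier_mat n p"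
    and La: "\<Lambda>\<^sub>a \<in> carrier_mat p p"
    and nonsing: "invertible_mat (X\<^sub>a @\<^sub>c X\<^sub>f)"
    and Ra_eq: "R\<^sub>a = - (M * X\<^sub>a * \<Lambda>\<^sub>a + K * X\<^sub>a)"
    and A_eq: "A = four_block_mat (X\<^sub>f * \<Lambda>\<^sub>f) (X\<^sub>a * \<Lambda>\<^sub>a) X\<^sub>f X\<^sub>a"
    and B_eq: "B = 0\<^sub>m n (n - p) @\<^sub>c R\<^sub>a"
  shows "invertible_mat (mat_adjoint A * A) \<and>
    is_moore_penrose_inverse A (pinv A) \<and>
    (\<forall>\<Delta>M \<in> carrier_mat n n. \<forall>\<Delta>K \<in> carrier_mat n n.
       complementary_deflating_pairs n (M + \<Delta>M) (K + \<Delta>K) p X\<^sub>a \<Lambda>\<^sub>a (n - p) X\<^sub>f \<Lambda>\<^sub>f \<longleftrightarrow>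
       (\<exists>Z \<in> carrier_mat n (2 * n).
          \<Delta>M @\<^sub>c \<Delta>K = B * pinv A + Z * (1\<^sub>m (2 * n) - A * pinv A)))"
proof -
  have pq: "n = p + (n - p)" and n2: "2 * n = n + n" using p_le_n by auto
  have Xf: "X\<^sub>f \<in> carrier_mat n (n - p)" and Lf: "\<Lambda>\<^sub>f \<in> carrier_mat (n - p) (n - p)"
    and rank_f: "vec_space.rank n X\<^sub>f = n - p"
    and res_f: "M * X\<^sub>f * \<Lambda>\<^sub>f + K * X\<^sub>f = 0\<^sub>m n (n - p)"
    using compl unfolding complementary_deflating_pairs_def deflating_pair_def by auto
  have XfL: "X\<^sub>f * \<Lambda>\<^sub>f \<in> carrier_mat n (n - p)" and XaL: "X\<^sub>a * \<Lambda>\<^sub>a \<in> carrier_mat n p"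
    using Xf Lf Xa La by auto
  have neg_zero: "- 0\<^sub>m n (n - p) = (0\<^sub>m n (n - p) :: complex mat)" by (intro eq_matI) auto
  have Ra: "R\<^sub>a \<in> carrier_mat n p" unfolding Ra_eq using M K Xa La by auto
  have A: "A \<in> carrier_mat (2 * n) n"
    unfolding A_eq n2 using four_block_carrier_mat[OF XfL Xa] p_le_n by simp
  have B: "B \<in> carrier_mat n n"
    unfolding B_eq using append_cols_carrier[OF zero_carrier_mat Ra, of "n - p"] p_le_n by simp
  obtain P Q where P: "P \<in> carrier_mat p n" and Q: "Q \<in> carrier_mat (n - p) n"
    and PX: "P * X\<^sub>a = 1\<^sub>m p" "P * X\<^sub>f = 0\<^sub>m p (n - p)"
    and QX: "Q * X\<^sub>a = 0\<^sub>m (n - p) p" "Q * X\<^sub>f = 1\<^sub>m (n - p)"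
    using complementary_left_inverses[OF Xa Xf pq nonsing] .
  have rank_a: "vec_space.rank n X\<^sub>a = p" using rank_of_left_invertible[OF Xa P PX(1)] .
  \<comment> \<open>The zero blocks ignore the upper half of \<open>A\<close>; the rows of \<open>[X\<^sub>a X\<^sub>f]\<inverse>\<close> are swapped
    because \<open>A\<close> puts \<open>X\<^sub>f\<close> first.\<close>
  define G where "G = four_block_mat (0\<^sub>m (n - p) n) Q (0\<^sub>m p n) P"
  have G: "G \<in> carrier_mat n (2 * n)"
    unfolding G_def n2 using four_block_carrier_mat[OF zero_carrier_mat P, of "n - p" n] p_le_n
    by simp
  have "G * A = four_block_mat (1\<^sub>m (n - p)) (0\<^sub>m (n - p) p) (0\<^sub>m p (n - p)) (1\<^sub>m p)"
    unfolding G_def A_eq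
      mult_four_block_mat[OF zero_carrier_mat Q zero_carrier_mat P XfL XaL Xf Xa]
      left_mult_zero_mat[OF XfL] left_mult_zero_mat[OF XaL]
    using PX QX by simp
  then have GA: "G * A = 1\<^sub>m n" using p_le_n by simp
  note pinv = pinv_of_left_invertible[OF A G GA]
  have "complementary_deflating_pairs n (M + \<Delta>M) (K + \<Delta>K) p X\<^sub>a \<Lambda>\<^sub>a (n - p) X\<^sub>f \<Lambda>\<^sub>f \<longleftrightarrow>
      (\<exists>Z \<in> carrier_mat n (2 * n).
        \<Delta>M @\<^sub>c \<Delta>K = B * pinv A + Z * (1\<^sub>m (2 * n) - A * pinv A))"
    if dM: "\<Delta>M \<in> carrier_mat n n" and dK: "\<Delta>K \<in> carrier_mat n n" for \<Delta>M \<Delta>K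
  proof -
    have D: "\<Delta>M @\<^sub>c \<Delta>K \<in> carrier_mat n (2 * n)"
      unfolding n2 using append_cols_carrier[OF dM dK] .
    have c1: "\<Delta>M * (X\<^sub>f * \<Lambda>\<^sub>f) + \<Delta>K * X\<^sub>f \<in> carrier_mat n (n - p)"
      and c2: "\<Delta>M * (X\<^sub>a * \<Lambda>\<^sub>a) + \<Delta>K * X\<^sub>a \<in> carrier_mat n p"
      using dM dK XfL XaL Xf Xa by auto
    have "complementary_deflating_pairs n (M + \<Delta>M) (K + \<Delta>K) p X\<^sub>a \<Lambda>\<^sub>a (n - p) X\<^sub>f \<Lambda>\<^sub>f \<longleftrightarrow>
        (M + \<Delta>M) * X\<^sub>f * \<Lambda>\<^sub>f + (K + \<Delta>K) * X\<^sub>f = 0\<^sub>m n (n - p) \<and>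
        (M + \<Delta>M) * X\<^sub>a * \<Lambda>\<^sub>a + (K + \<Delta>K) * X\<^sub>a = 0\<^sub>m n p"
      unfolding complementary_deflating_pairs_def deflating_pair_def
      using M K dM dK Xa La Xf Lf rank_a rank_f nonsing p_le_n by auto
    also have "\<dots> \<longleftrightarrow> \<Delta>M * (X\<^sub>f * \<Lambda>\<^sub>f) + \<Delta>K * X\<^sub>f = 0\<^sub>m n (n - p) \<and>
        \<Delta>M * (X\<^sub>a * \<Lambda>\<^sub>a) + \<Delta>K * X\<^sub>a = R\<^sub>a"
      unfolding perturbed_residual_zero_iff[OF M dM K dK Xf Lf]
        perturbed_residual_zero_iff[OF M dM K dK Xa La] res_f Ra_eq
        neg_zero ..
    also have "\<dots> \<longleftrightarrow> (\<Delta>M @\<^sub>c \<Delta>K) * A = B"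
      unfolding A_eq B_eq append_cols_mult_four_block[OF dM dK XfL XaL Xf Xa]
        append_cols_eq_iff[OF c1 c2 zero_carrier_mat Ra] ..
    also have "\<dots> \<longleftrightarrow> (\<exists>Z \<in> carrier_mat n (2 * n).
        \<Delta>M @\<^sub>c \<Delta>K = B * pinv A + Z * (1\<^sub>m (2 * n) - A * pinv A))"
      using left_inverse_solutions[OF A pinv(2,3) B D] .
    finally show ?thesis .
  qed
  then show ?thesis using pinv(1,4) by blast
qed

end
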